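(* Let $m \geq 4$ and let $n$ be an even positive integer. Then the radio number of the stacked-book graph $G_{m,n}=S_m \Box P_n$ is $$rn(G_{m,n})=\frac{mn^2}{2}+n-1.$$
   Context: $S_m$ denotes the star on $m$ vertices (one center vertex adjacent to $m-1$ leaves) and $P_n$ the path on $n$ vertices. The stacked-book graph $G_{m,n}=S_m \Box P_n$ is their Cartesian product. For a simple connected graph $G$ with distance $d$ and diameter $\mathrm{diam}(G)$, a radio labeling is a function $f:V(G)\to \mathbb{Z}_{\ge 0}$ such that $|f(u)-f(v)|\geq \mathrm{diam}(G)+1-d(u,v)$ for all distinct $u,v\in V(G)$. The span of $f$ is $\max_{v} f(v)-\min_{v} f(v)$. The radio number $rn(G)$ is the minimum span over all radio labelings of $G$. *)

theory Defs
  imports "Graph_Theory.Graph_Theory"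
begin

text \<open>
  Undirected graphs are symmetric digraphs whose arcs are pairs of vertices: the edge
  \<open>{u, v}\<close> is represented by the two arcs \<open>(u, v)\<close> and \<open>(v, u)\<close>.
\<close>

text \<open>The center of the star is the vertex \<open>0\<close>.\<close>

definition star_graph :: "nat \<Rightarrow> nat pair_pre_digraph" where
  "star_graph m =
     \<lparr> pverts = {..<m},
       parcs = {(u, v). u < m \<and> v < m \<and> u \<noteq> v \<and> (u = 0 \<or> v = 0)} \<rparr>"

definition path_graph :: "nat \<Rightarrow> nat pair_pre_digraph" where
  "path_graph n =
     \<lparr> pverts = {..<n},
       parcs = {(u, v). u < n \<and> v < n \<and> (v = Suc u \<or> u = Suc v)} \<rparr>"

definition cartesian_product ::
  "'a pair_pre_digraph \<Rightarrow> 'b pair_pre_digraph \<Rightarrow> ('a \<times> 'b) pair_pre_digraph" where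
  "cartesian_product G H =
     \<lparr> pverts = pverts G \<times> pverts H,
       parcs = {((a, b), (a', b')) | a b a' b'.
                  (a = a' \<and> a \<in> pverts G \<and> (b, b') \<in> parcs H) \<or>
                  (b = b' \<and> b \<in> pverts H \<and> (a, a') \<in> parcs G)} \<rparr>"

definition stacked_book :: "nat \<Rightarrow> nat \<Rightarrow> (nat \<times> nat) pair_pre_digraph" where
  "stacked_book m n = cartesian_product (star_graph m) (path_graph n)"

text \<open>Meaningful only if \<open>v\<close> is reachable from \<open>u\<close>.\<close>

definition graph_dist :: "'a pair_pre_digraph \<Rightarrow> 'a \<Rightarrow> 'a \<Rightarrow> nat" where
  "graph_dist G u v = (LEAST k. \<exists>p. pre_digraph.awalk (with_proj G) u p v \<and> length p = k)"

definition graph_diam :: "'a pair_pre_digraph \<Rightarrow> nat" where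
  "graph_diam G = Max {graph_dist G u v | u v. u \<in> pverts G \<and> v \<in> pverts G}"

definition radio_labeling :: "'a pair_pre_digraph \<Rightarrow> ('a \<Rightarrow> nat) \<Rightarrow> bool" where
  "radio_labeling G f \<longleftrightarrow>
     (\<forall>u \<in> pverts G. \<forall>v \<in> pverts G. u \<noteq> v \<longrightarrow>
        \<bar>int (f u) - int (f v)\<bar> \<ge> int (graph_diam G) + 1 - int (graph_dist G u v))"

definition label_span :: "'a pair_pre_digraph \<Rightarrow> ('a \<Rightarrow> nat) \<Rightarrow> nat" where
  "label_span G f = Max (f ` pverts G) - Min (f ` pverts G)"

definition radio_number :: "'a pair_pre_digraph \<Rightarrow> nat" where
  "radio_number G = (LEAST k. \<exists>f. radio_labeling G f \<and> label_span G f = k)"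

lemma pair_graph_star_graph: "pair_graph (star_graph m)"
proof -
  have "finite {(u, v). u < m \<and> v < m \<and> u \<noteq> v \<and> (u = 0 \<or> v = 0)}"
    by (rule finite_subset[of _ "{..<m} \<times> {..<m}"]) auto
  then show ?thesis
    by unfold_locales (auto simp: star_graph_def symmetric_def sym_def arcs_ends_def arc_to_ends_def)
qed

lemma pair_graph_path_graph: "pair_graph (path_graph n)"
proof -
  have "finite {(u, v). u < n \<and> v < n \<and> (v = Suc u \<or> u = Suc v)}"
    by (rule finite_subset[of _ "{..<n} \<times> {..<n}"]) auto
  then show ?thesis
    by unfold_locales (auto simp: path_graph_def symmetric_def sym_def arcs_ends_def arc_to_ends_def)
qed

lemma pair_graph_cartesian_product:
  assumes "pair_graph G" "pair_graph H"
  shows "pair_graph (cartesian_product G H)"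
proof -
  interpret G: pair_graph G by fact
  interpret H: pair_graph H by fact
  have wf: "fst e \<in> pverts G \<times> pverts H \<and> snd e \<in> pverts G \<times> pverts H"
    if "e \<in> parcs (cartesian_product G H)" for e
    using that
    by (auto simp: cartesian_product_def dest: G.in_arcsD1 G.in_arcsD2 H.in_arcsD1 H.in_arcsD2)
  have "finite (parcs (cartesian_product G H))"
  proof (rule finite_subset)
    show "parcs (cartesian_product G H) \<subseteq> (pverts G \<times> pverts H) \<times> (pverts G \<times> pverts H)"
      using wf by (metis mem_Times_iff subsetI)
    show "finite ((pverts G \<times> pverts H) \<times> (pverts G \<times> pverts H))"
      by simp
  qed
  moreover have "symmetric (with_proj (cartesian_product G H))"
    by (auto simp: cartesian_product_def symmetric_def sym_def intro: G.arcs_symmetric H.arcs_symmetric)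
  moreover have "fst e \<noteq> snd e" if "e \<in> parcs (cartesian_product G H)" for e
    using that by (auto simp: cartesian_product_def dest: G.no_loops' H.no_loops')
  moreover have "pverts (cartesian_product G H) = pverts G \<times> pverts H"
    by (simp add: cartesian_product_def)
  ultimately show ?thesis
    by (unfold_locales) (simp_all add: wf)
qed

lemma pair_graph_stacked_book: "pair_graph (stacked_book m n)"
  unfolding stacked_book_def
  by (intro pair_graph_cartesian_product pair_graph_star_graph pair_graph_path_graph)

text \<open>The distance is the library's shortest-path distance for unit arc weights.\<close>

lemma (in pair_wf_digraph) graph_dist_eq_\<mu>:
  assumes "awalk u p v"
  shows "ereal (real (graph_dist G u v)) = \<mu> (\<lambda>_. 1) u v"
proof -
  have cost: "awalk_cost (\<lambda>_. 1) q = real (length q)" for q :: "('a \<times> 'a) list"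
    by (induct q) auto
  obtain q where q: "awalk u q v" "length q = graph_dist G u v"
    using LeastI_ex[of "\<lambda>k. \<exists>p. awalk u p v \<and> length p = k"] assms
    unfolding graph_dist_def by auto
  have le: "graph_dist G u v \<le> length r" if "awalk u r v" for r
    unfolding graph_dist_def using that by (auto intro: Least_le)
  show ?thesis
    unfolding \<mu>_def cost
  proof (rule antisym)
    show "ereal (real (graph_dist G u v)) \<le> (INF p\<in>{p. awalk u p v}. ereal (real (length p)))"
      by (auto intro!: INF_greatest le)
    show "(INF p\<in>{p. awalk u p v}. ereal (real (length p))) \<le> ereal (real (graph_dist G u v))"
      using q by (auto intro!: INF_lower2[of q])
  qed
qed

end

theory Submission
  imports Defs
begin

text \<open>
  Distances in the stacked book are star distance plus path distance, and the diameter is \<open>n + 1\<close>.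
  List the vertices by increasing label; consecutive labels differ by at least \<open>n + 2 - d\<close>, and
  each \<open>d\<close> is at most the sum of the distances of its endpoints to the midpoint of the central
  column. Summing over the list counts every vertex twice except the two ends, whose distance to
  the midpoint is at least \<open>1/2\<close>; this is the lower bound. Equality forces the list to alternate
  between the lower and the upper half, to avoid consecutive vertices on the same leaf, and to
  start and end at the two middle centers. With \<open>n = 2h\<close> such a list is obtained by running
  through the pairs of rows \<open>(a, a + h)\<close>, \<open>a = h - 1, \<dots>, 0\<close>, visiting in each pair the columns
  \<open>0, 2, 1, 3, 2, 4, \<dots>, m - 3, m - 1, m - 2, 1, m - 1, 0\<close>, alternately in the lower and in the
  upper row.
\<close>

section \<open>Distances\<close>

text \<open>A potential \<open>D\<close> that vanishes at \<open>v\<close> and drops by at most one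
  along each arc bounds every walk to \<open>v\<close> from below; following arcs on which it drops
  by exactly one yields a walk of that length.\<close>

lemma (in pair_wf_digraph) graph_dist_eqI:
  assumes v: "v \<in> pverts G" and u: "u \<in> pverts G"
    and zero: "D v = 0"
    and arc: "\<And>x y. (x, y) \<in> parcs G \<Longrightarrow> D x \<le> Suc (D y)"
    and descent: "\<And>x. x \<in> pverts G \<Longrightarrow> x \<noteq> v \<Longrightarrow> \<exists>y. (x, y) \<in> parcs G \<and> D x = Suc (D y)"
  shows "graph_dist G u v = D u"
proof -
  have lower: "D x \<le> length p" if "awalk x p v" for x p
    using that
  proof (induction p arbitrary: x)
    case Nil
    then show ?case using zero by (simp add: awalk_Nil_iff)
  next
    case (Cons e p)
    then have "e \<in> parcs G" "fst e = x" "awalk (snd e) p v"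
      by (auto simp: awalk_Cons_iff)
    then show ?case
      using Cons.IH[of "snd e"] arc[of x "snd e"] by (cases e) auto
  qed
  have ex: "\<exists>p. awalk x p v \<and> length p = D x" if "x \<in> pverts G" for x
    using that
  proof (induction "D x" arbitrary: x)
    case 0
    then have "x = v" using descent by fastforce
    then show ?case using v zero by (intro exI[of _ "[]"]) (simp add: awalk_Nil_iff)
  next
    case (Suc k)
    then have "x \<noteq> v" using zero by auto
    then obtain y where y: "(x, y) \<in> parcs G" "D x = Suc (D y)"
      using descent Suc.prems by blast
    then have "y \<in> pverts G" by (auto dest: in_arcsD2)
    then obtain p where "awalk y p v" "length p = D y"
      using Suc.hyps y by auto
    then show ?case
      using y Suc.prems by (intro exI[of _ "(x, y) # p"]) (auto simp: awalk_Cons_iff)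
  qed
  show ?thesis
    unfolding graph_dist_def using ex[OF u] lower by (auto intro!: Least_equality)
qed

definition star_dist :: "nat \<Rightarrow> nat \<Rightarrow> nat" where
  "star_dist a b = (if a = b then 0 else if a = 0 \<or> b = 0 then 1 else 2)"

definition book_dist :: "nat \<times> nat \<Rightarrow> nat \<times> nat \<Rightarrow> nat" where
  "book_dist u v = star_dist (fst u) (fst v) + nat \<bar>int (snd u) - int (snd v)\<bar>"

lemma pverts_stacked_book: "pverts (stacked_book m n) = {..<m} \<times> {..<n}"
  by (simp add: stacked_book_def cartesian_product_def star_graph_def path_graph_def)

lemma parcs_stacked_book:
  "((a, b), (a', b')) \<in> parcs (stacked_book m n) \<longleftrightarrow>
     a < m \<and> a' < m \<and> b < n \<and> b' < n \<and>
     (a = a' \<and> (b' = Suc b \<or> b = Suc b') \<or> b = b' \<and> a \<noteq> a' \<and> (a = 0 \<or> a' = 0))"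
  by (auto simp: stacked_book_def cartesian_product_def star_graph_def path_graph_def)

lemma graph_dist_stacked_book:
  assumes "u \<in> {..<m} \<times> {..<n}" "v \<in> {..<m} \<times> {..<n}"
  shows "graph_dist (stacked_book m n) u v = book_dist u v"
proof -
  interpret pair_graph "stacked_book m n" by (rule pair_graph_stacked_book)
  show ?thesis
  proof (rule graph_dist_eqI[where D = "\<lambda>x. book_dist x v"])
    show "v \<in> pverts (stacked_book m n)" "u \<in> pverts (stacked_book m n)"
      using assms by (simp_all add: pverts_stacked_book)
    show "book_dist v v = 0" by (simp add: book_dist_def star_dist_def)
    show "book_dist x v \<le> Suc (book_dist y v)" if "(x, y) \<in> parcs (stacked_book m n)" for x y
      using that by (cases x; cases y) (auto simp: parcs_stacked_book book_dist_def star_dist_def)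
  next
    fix x assume x: "x \<in> pverts (stacked_book m n)" "x \<noteq> v"
    obtain a b a' b' where ab: "x = (a, b)" "v = (a', b')" by (cases x; cases v)
    have lt: "a < m" "b < n" "a' < m" "b' < n"
      using x(1) assms(2) by (auto simp: ab pverts_stacked_book)
    \<comment> \<open>Move to the row of \<open>v\<close> first, then along the star, where two
      distinct leaves are joined only through the center \<open>0\<close>.\<close>
    let ?y = "if b < b' then (a, Suc b) else if b > b' then (a, b - 1)
              else if a = 0 then (a', b) else (0, b)"
    have "(x, ?y) \<in> parcs (stacked_book m n) \<and> book_dist x v = Suc (book_dist ?y v)"
      using lt x(2) by (auto simp: ab parcs_stacked_book book_dist_def star_dist_def)
    then show "\<exists>y. (x, y) \<in> parcs (stacked_book m n) \<and> book_dist x v = Suc (book_dist y v)"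
      by blast
  qed
qed

lemma graph_diam_stacked_book:
  assumes "m \<ge> 3" "n > 0"
  shows "graph_diam (stacked_book m n) = n + 1"
proof -
  let ?V = "{..<m} \<times> {..<n}"
  have "graph_diam (stacked_book m n) = Max {book_dist u v | u v. u \<in> ?V \<and> v \<in> ?V}"
    unfolding graph_diam_def pverts_stacked_book
    by (intro arg_cong[where f = Max] Collect_cong) (metis graph_dist_stacked_book)
  also have "\<dots> = n + 1"
  proof (rule Max_eqI)
    have "{book_dist u v | u v. u \<in> ?V \<and> v \<in> ?V} = (\<lambda>(u, v). book_dist u v) ` (?V \<times> ?V)"
      by auto
    then show "finite {book_dist u v | u v. u \<in> ?V \<and> v \<in> ?V}" by simp
    show "d \<le> n + 1" if "d \<in> {book_dist u v | u v. u \<in> ?V \<and> v \<in> ?V}" for d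
      using that by (auto simp: book_dist_def star_dist_def)
    \<comment> \<open>Two distinct leaves in opposite end rows realize the diameter; they exist
      since \<open>m >= 3\<close>.\<close>
    have "n + 1 = book_dist (1, 0) (2, n - 1)" "(1, 0) \<in> ?V" "(2, n - 1) \<in> ?V"
      using assms by (auto simp: book_dist_def star_dist_def)
    then show "n + 1 \<in> {book_dist u v | u v. u \<in> ?V \<and> v \<in> ?V}" by blast
  qed
  finally show ?thesis .
qed

lemma radio_labeling_stacked_book:
  assumes "m \<ge> 3" "n > 0"
  shows "radio_labeling (stacked_book m n) f \<longleftrightarrow>
    (\<forall>u \<in> {..<m} \<times> {..<n}. \<forall>v \<in> {..<m} \<times> {..<n}. u \<noteq> v \<longrightarrow>
       \<bar>int (f u) - int (f v)\<bar> \<ge> int n + 2 - int (book_dist u v))"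
proof -
  have "int (graph_diam (stacked_book m n)) + 1 = int n + 2"
    using assms by (simp add: graph_diam_stacked_book)
  then show ?thesis
    unfolding radio_labeling_def pverts_stacked_book
    by (simp only: graph_dist_stacked_book cong: ball_cong)
qed

section \<open>Lower bound\<close>

text \<open>The gaps between neighbors of the sorted list telescope. Each inner weight occurs in two
  gaps and each end weight in one, so the end weights are added back.\<close>

lemma sorted_label_difference:
  fixes f :: "'a \<Rightarrow> nat" and w :: "'a \<Rightarrow> int"
  assumes "xs \<noteq> []" "distinct xs" "sorted (map f xs)"
    and "\<And>u v. u \<in> set xs \<Longrightarrow> v \<in> set xs \<Longrightarrow> u \<noteq> v \<Longrightarrow>
           2 * \<bar>int (f u) - int (f v)\<bar> \<ge> c - w u - w v"
  shows "2 * (int (f (last xs)) - int (f (hd xs))) \<ge>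
           (int (length xs) - 1) * c - 2 * (\<Sum>x\<in>set xs. w x) + w (hd xs) + w (last xs)"
  using assms
proof (induction xs rule: list_nonempty_induct)
  case (single x)
  then show ?case by simp
next
  case (cons x xs)
  then obtain y ys where xs: "xs = y # ys" by (cases xs) auto
  have "2 * (int (f (last xs)) - int (f (hd xs))) \<ge>
           (int (length xs) - 1) * c - 2 * (\<Sum>x\<in>set xs. w x) + w (hd xs) + w (last xs)"
    using cons by simp
  moreover have "2 * (int (f y) - int (f x)) \<ge> c - w y - w x"
  proof -
    have "f x \<le> f y" "x \<noteq> y" using cons.prems by (auto simp: xs)
    then show ?thesis using cons.prems(3)[of y x] by (simp add: xs)
  qed
  moreover have "x \<notin> set xs" using cons.prems by simp
  ultimately show ?case
    unfolding xs by (simp add: algebra_simps del: distinct.simps)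
qed

lemma label_span_lower_bound:
  fixes f :: "'a \<Rightarrow> nat" and w :: "'a \<Rightarrow> int"
  assumes fin: "finite (pverts G)" and ne: "pverts G \<noteq> {}"
    and sep: "\<And>u v. u \<in> pverts G \<Longrightarrow> v \<in> pverts G \<Longrightarrow> u \<noteq> v \<Longrightarrow>
           2 * \<bar>int (f u) - int (f v)\<bar> \<ge> c - w u - w v"
    and w: "\<And>u. u \<in> pverts G \<Longrightarrow> w u \<ge> 1"
  shows "2 * int (label_span G f) \<ge>
           (int (card (pverts G)) - 1) * c - 2 * (\<Sum>x\<in>pverts G. w x) + 2"
proof -
  obtain ys where ys: "set ys = pverts G" "distinct ys"
    using finite_distinct_list[OF fin] by blast
  define xs where "xs = sort_key f ys"
  have xs: "set xs = pverts G" "distinct xs" "sorted (map f xs)"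
    using ys by (simp_all add: xs_def)
  then have ne': "xs \<noteq> []" using ne by auto
  then have ends: "hd xs \<in> pverts G" "last xs \<in> pverts G" using xs by auto
  have "2 * (int (f (last xs)) - int (f (hd xs))) \<ge>
           (int (length xs) - 1) * c - 2 * (\<Sum>x\<in>set xs. w x) + w (hd xs) + w (last xs)"
    using xs sep by (intro sorted_label_difference[OF ne']) auto
  moreover have "length xs = card (pverts G)"
    using xs distinct_card by metis
  moreover have "int (f (last xs)) - int (f (hd xs)) \<le> int (label_span G f)"
  proof -
    have "f (last xs) \<le> Max (f ` pverts G)" "Min (f ` pverts G) \<le> f (hd xs)"
      using fin ends by auto
    then show ?thesis by (simp add: label_span_def)
  qed
  ultimately show ?thesis
    using w[OF ends(1)] w[OF ends(2)] xs(1) by simp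
qed

text \<open>Twice the distance from \<open>u\<close> to the midpoint of the central column, so that
  \<open>2 d(u, v) \<le> eccentricity n u + eccentricity n v\<close>; doubling avoids half-integers.\<close>

definition eccentricity :: "nat \<Rightarrow> nat \<times> nat \<Rightarrow> int" where
  "eccentricity n u = (if fst u = 0 then 0 else 2) + \<bar>2 * int (snd u) + 1 - int n\<bar>"

text \<open>Reflecting the lower rows and shifting the upper ones turns each half into the sum of
  the first \<open>h\<close> odd numbers, which is the square of \<open>h\<close>.\<close>

lemma sum_eccentricity:
  "m > 0 \<Longrightarrow> (\<Sum>u\<in>{..<m} \<times> {..<2 * h}. eccentricity (2 * h) u) =
     4 * (int m - 1) * int h + 2 * int m * (int h)\<^sup>2"
proof -
  assume m: "m > 0"
  have rows: "(\<Sum>j<2 * h. \<bar>2 * int j + 1 - int (2 * h)\<bar>) = 2 * (int h)\<^sup>2"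
  proof -
    have pos: "(\<Sum>i<h. 2 * int i + 1) = (int h)\<^sup>2" for h
      by (induction h) (auto simp: power2_eq_square algebra_simps)
    have "{..<2 * h} = {..<h} \<union> {h..<2 * h}" by auto
    then have "(\<Sum>j<2 * h. \<bar>2 * int j + 1 - int (2 * h)\<bar>) =
        (\<Sum>j<h. \<bar>2 * int j + 1 - int (2 * h)\<bar>) + (\<Sum>j=h..<2 * h. \<bar>2 * int j + 1 - int (2 * h)\<bar>)"
      by (metis (no_types, lifting) finite_atLeastLessThan finite_lessThan ivl_disj_int_one(2)
          lessThan_atLeast0 sum.union_disjoint ivl_disj_int_two(3))
    moreover have "(\<Sum>j<h. \<bar>2 * int j + 1 - int (2 * h)\<bar>) = (\<Sum>i<h. 2 * int i + 1)"
      by (rule sum.reindex_bij_witness[of _ "\<lambda>i. h - Suc i" "\<lambda>i. h - Suc i"]) auto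
    moreover have "(\<Sum>j=h..<2 * h. \<bar>2 * int j + 1 - int (2 * h)\<bar>) = (\<Sum>i<h. 2 * int i + 1)"
      by (rule sum.reindex_bij_witness[of _ "\<lambda>i. i + h" "\<lambda>i. i - h"]) auto
    ultimately show ?thesis by (simp add: pos)
  qed
  have cols: "(\<Sum>a<m. (if a = 0 then 0 else 2) :: int) = 2 * (int m - 1)"
    using m by (induction m rule: nat_induct_non_zero) auto
  have "(\<Sum>u\<in>{..<m} \<times> {..<2 * h}. eccentricity (2 * h) u) =
      (\<Sum>a<m. \<Sum>j<2 * h. (if a = 0 then 0 else 2) + \<bar>2 * int j + 1 - int (2 * h)\<bar>)"
    by (simp add: sum.cartesian_product eccentricity_def case_prod_beta)
  also have "\<dots> = 2 * int h * (\<Sum>a<m. (if a = 0 then 0 else 2)) + int m * (2 * (int h)\<^sup>2)"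
    using rows by (simp add: sum.distrib sum_distrib_left)
  finally show ?thesis by (simp add: cols algebra_simps)
qed

lemma label_span_stacked_book_ge:
  assumes m: "m \<ge> 3" and h: "h > 0" and f: "radio_labeling (stacked_book m (2 * h)) f"
  shows "2 * m * h\<^sup>2 + 2 * h - 1 \<le> label_span (stacked_book m (2 * h)) f"
proof -
  let ?G = "stacked_book m (2 * h)"
  have n: "2 * h > 0" using h by simp
  \<comment> \<open>The constant \<open>4 * h + 4\<close> is twice \<open>n + 2\<close> for
    \<open>n = 2 * h\<close>, matching the doubled eccentricities.\<close>
  have "2 * int (label_span ?G f) \<ge> (int (card (pverts ?G)) - 1) * (4 * int h + 4)
          - 2 * (\<Sum>u\<in>pverts ?G. eccentricity (2 * h) u) + 2"
  proof (rule label_span_lower_bound)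
    show "finite (pverts ?G)" "pverts ?G \<noteq> {}"
      using m h by (simp_all add: pverts_stacked_book lessThan_empty_iff)
    show "eccentricity (2 * h) u \<ge> 1" for u
    proof -
      \<comment> \<open>The number of rows is even, so this integer is odd: no vertex lies at the
        midpoint.\<close>
      have "2 * int (snd u) + 1 - int (2 * h) \<noteq> 0" by presburger
      then have "\<bar>2 * int (snd u) + 1 - int (2 * h)\<bar> \<ge> 1" by linarith
      then show ?thesis by (simp add: eccentricity_def)
    qed
    fix u v assume uv: "u \<in> pverts ?G" "v \<in> pverts ?G" "u \<noteq> v"
    have "2 * int (book_dist u v) \<le> eccentricity (2 * h) u + eccentricity (2 * h) v"
    proof -
      have "2 * int (star_dist (fst u) (fst v)) \<le>
          (if fst u = 0 then 0 else 2) + (if fst v = 0 then 0 else 2)"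
        by (simp add: star_dist_def)
      moreover have "2 * \<bar>int (snd u) - int (snd v)\<bar> \<le>
          \<bar>2 * int (snd u) + 1 - int (2 * h)\<bar> + \<bar>2 * int (snd v) + 1 - int (2 * h)\<bar>"
        by (smt (verit))
      ultimately show ?thesis by (simp add: book_dist_def eccentricity_def)
    qed
    moreover have "\<bar>int (f u) - int (f v)\<bar> \<ge> int (2 * h) + 2 - int (book_dist u v)"
      using f[unfolded radio_labeling_stacked_book[OF m n]] uv
      unfolding pverts_stacked_book by blast
    ultimately show "4 * int h + 4 - eccentricity (2 * h) u - eccentricity (2 * h) v
        \<le> 2 * \<bar>int (f u) - int (f v)\<bar>"
      by simp
  qed
  then have "2 * int (label_span ?G f) \<ge> (2 * int m * int h - 1) * (4 * int h + 4)
          - 2 * (4 * (int m - 1) * int h + 2 * int m * (int h)\<^sup>2) + 2"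
    using m sum_eccentricity[of m h] by (simp add: pverts_stacked_book mult.assoc mult.left_commute)
  then have "int (label_span ?G f) \<ge> 2 * int m * (int h)\<^sup>2 + 2 * int h - 1"
    by (simp add: algebra_simps power2_eq_square)
  then have "int (2 * m * h\<^sup>2 + 2 * h) \<le> int (label_span ?G f + 1)"
    by simp
  then show ?thesis by linarith
qed

section \<open>An optimal labeling\<close>

text \<open>The block numbers the pairs of rows \<open>(a, a + h)\<close> downwards from \<open>a = h - 1\<close>; the slot is the
  place of \<open>u\<close> in the column sequence \<open>0, 2, 1, 3, 2, 4, \<dots>, m - 2, 1, m - 1, 0\<close> of its block.\<close>

definition book_block :: "nat \<Rightarrow> nat \<times> nat \<Rightarrow> nat" where
  "book_block h u = (if snd u < h then h - 1 - snd u else 2 * h - 1 - snd u)"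

definition book_slot :: "nat \<Rightarrow> nat \<Rightarrow> nat \<times> nat \<Rightarrow> nat" where
  "book_slot m h u =
     (if snd u < h then 2 * fst u
      else if fst u = 0 then 2 * m - 1
      else if fst u = 1 then 2 * m - 3
      else 2 * fst u - 3)"

text \<open>Consecutive slots are at distance \<open>h + 2\<close> and so cost \<open>h\<close>, except that the first and the
  last step of a block meet a center and cost \<open>h + 1\<close>.\<close>

definition slot_label :: "nat \<Rightarrow> nat \<Rightarrow> nat \<Rightarrow> nat" where
  "slot_label m h r = r * h + (if r = 0 then 0 else if r = 2 * m - 1 then 2 else 1)"

text \<open>The period \<open>2 * m * h + 3\<close> is the last slot label
  \<open>(2 * m - 1) * h + 2\<close> plus \<open>h + 1\<close>, the cost of passing from the upper
  center of a block to the lower center of the next, at distance \<open>h + 1\<close>.\<close>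

definition book_label :: "nat \<Rightarrow> nat \<Rightarrow> nat \<times> nat \<Rightarrow> nat" where
  "book_label m h u = book_block h u * (2 * m * h + 3) + slot_label m h (book_slot m h u)"

lemma book_slot_less: "m \<ge> 4 \<Longrightarrow> fst u < m \<Longrightarrow> book_slot m h u < 2 * m"
  by (auto simp: book_slot_def)

lemma even_book_slot: "m \<ge> 4 \<Longrightarrow> even (book_slot m h u) \<longleftrightarrow> snd u < h"
  by (auto simp: book_slot_def)

text \<open>Slot parity determines the half, the block then gives the row and the slot the column.
  In the upper half the columns from \<open>2\<close> on use odd slots up to
  \<open>2 * m - 5\<close>, clear of the two exceptional values.\<close>

lemma book_position_inj:
  assumes "m \<ge> 4" "u \<in> {..<m} \<times> {..<2 * h}" "v \<in> {..<m} \<times> {..<2 * h}"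
    and "book_block h u = book_block h v" "book_slot m h u = book_slot m h v"
  shows "u = v"
proof (cases "snd u < h")
  case True
  then have "snd v < h" using even_book_slot assms(1,5) by metis
  with True show ?thesis
    using assms(4,5) by (auto simp: book_block_def book_slot_def prod_eq_iff)
next
  case False
  then have high: "\<not> snd v < h" using even_book_slot assms(1,5) by metis
  with False have "snd u = snd v"
    using assms(2-4) by (auto simp: book_block_def)
  moreover have "fst u < m" "fst v < m" using assms(2,3) by auto
  with False high have "fst u = fst v"
    using assms(1,5) by (simp add: book_slot_def split: if_splits)
  ultimately show ?thesis by (simp add: prod_eq_iff)
qed

lemma book_dist_pos: "u \<noteq> v \<Longrightarrow> book_dist u v \<ge> 1"
  by (cases u; cases v) (auto simp: book_dist_def star_dist_def)

lemma slot_label_diff: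
  assumes "r < s" "s < 2 * m"
  shows "slot_label m h s \<ge> slot_label m h r + (s - r) * h + (if r = 0 then 1 else 0)
           + (if s = 2 * m - 1 then 1 else 0)"
proof -
  have "s * h = r * h + (s - r) * h" using assms by (simp flip: add_mult_distrib)
  then show ?thesis using assms by (auto simp: slot_label_def)
qed

lemma book_label_same_block:
  assumes m: "m \<ge> 4" and u: "u \<in> {..<m} \<times> {..<2 * h}" and v: "v \<in> {..<m} \<times> {..<2 * h}"
    and block: "book_block h u = book_block h v" and lt: "book_slot m h u < book_slot m h v"
  shows "book_label m h v + book_dist u v \<ge> book_label m h u + 2 * h + 2"
proof -
  define r s where rs: "r = book_slot m h u" "s = book_slot m h v"
  have s: "s < 2 * m" using book_slot_less[OF m] v by (auto simp: rs)
  have cols: "fst u < m" "fst v < m" and rows: "snd u < 2 * h" "snd v < 2 * h"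
    using u v by auto
  have "u \<noteq> v" using lt by auto
  then have pos: "book_dist u v \<ge> 1" by (rule book_dist_pos)
  have h: "h \<ge> 1" using u by auto
  have diff: "slot_label m h s \<ge> slot_label m h r + (s - r) * h + (if r = 0 then 1 else 0)
           + (if s = 2 * m - 1 then 1 else 0)"
    using lt s by (intro slot_label_diff) (auto simp: rs)
  consider "s - r = 1" | "s - r = 2" | "s - r \<ge> 3" using lt by (fastforce simp: rs)
  then have "slot_label m h s + book_dist u v \<ge> slot_label m h r + 2 * h + 2"
  proof cases
    case 1
    then have "even r \<longleftrightarrow> odd s" by presburger
    then have "snd u < h \<longleftrightarrow> \<not> snd v < h"
      using even_book_slot[OF m] by (simp add: rs)
    \<comment> \<open>Neighboring slots never share a column; the critical pair is
      \<open>m - 2\<close> and \<open>1\<close>, distinct because \<open>m >= 4\<close>. Where a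
      center is met, the extra unit of the label replaces the missing unit of distance.\<close>
    then have "nat \<bar>int (snd u) - int (snd v)\<bar> = h" and
      "star_dist (fst u) (fst v) + (if r = 0 then 1 else 0) + (if s = 2 * m - 1 then 1 else 0) \<ge> 2"
      using 1 m cols rows block
      by (auto simp: rs book_slot_def book_block_def star_dist_def split: if_splits)
    then have "book_dist u v + (if r = 0 then 1 else 0) + (if s = 2 * m - 1 then 1 else 0) \<ge> h + 2"
      by (simp add: book_dist_def)
    with diff 1 show ?thesis by simp
  next
    case 2
    then have "even r \<longleftrightarrow> even s" by presburger
    then have "snd u < h \<longleftrightarrow> snd v < h"
      using even_book_slot[OF m] by (simp add: rs)
    then have "star_dist (fst u) (fst v) + (if r = 0 then 1 else 0) + (if s = 2 * m - 1 then 1 else 0) \<ge> 2"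
      using 2 m cols
      by (auto simp: rs book_slot_def star_dist_def split: if_splits)
    then have "book_dist u v + (if r = 0 then 1 else 0) + (if s = 2 * m - 1 then 1 else 0) \<ge> 2"
      by (simp add: book_dist_def)
    with diff 2 show ?thesis by simp
  next
    case 3
    \<comment> \<open>From three slots on, distance one suffices:
      \<open>3 * h + 1 >= 2 * h + 2\<close>.\<close>
    then have "3 * h \<le> (s - r) * h" by (rule mult_le_mono1)
    with diff pos h show ?thesis by linarith
  qed
  then show ?thesis by (simp add: book_label_def block rs)
qed

text \<open>It suffices to treat a block difference of one period, as further periods only increase
  the label gap. Only the step between the two centers then needs a distance beyond the trivial
  bound.\<close>

lemma book_label_less_block:
  assumes m: "m \<ge> 4" and u: "u \<in> {..<m} \<times> {..<2 * h}" and v: "v \<in> {..<m} \<times> {..<2 * h}"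
    and block: "book_block h u < book_block h v"
  shows "book_label m h v + book_dist u v \<ge> book_label m h u + 2 * h + 2"
proof -
  define r s where rs: "r = book_slot m h u" "s = book_slot m h v"
  define L where "L = 2 * m * h + 3"
  have r: "r < 2 * m" using book_slot_less[OF m] u by (auto simp: rs)
  have h: "h \<ge> 1" using u by auto
  have L: "book_block h v * L \<ge> book_block h u * L + L"
    using block mult_le_mono1[of "Suc (book_block h u)" "book_block h v" L] by simp
  \<comment> \<open>The number of slots from \<open>u\<close> to \<open>v\<close> if the block of
    \<open>v\<close> came directly after that of \<open>u\<close>.\<close>
  define g where "g = 2 * m - r + s"
  have g: "g * h + r * h = 2 * m * h + s * h"
    using r by (simp add: g_def flip: add_mult_distrib)
  have slot: "slot_label m h r \<le> r * h + 2" "slot_label m h s \<ge> s * h"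
    by (auto simp: slot_label_def)
  have "g \<ge> 1" using r by (simp add: g_def)
  then consider "g = 1" | "r = 2 * m - 1" "s = 1" | "r = 2 * m - 2" "s = 0" | "g \<ge> 3"
    using r by (fastforce simp: g_def)
  then have "L + slot_label m h s + book_dist u v \<ge> slot_label m h r + 2 * h + 2"
  proof cases
    case 1
    then have r': "r = 2 * m - 1" and s': "s = 0" using r by (auto simp: g_def)
    have "odd r" "even s" using r' s' m by auto
    then have "\<not> snd u < h" "snd v < h" using even_book_slot[OF m] by (simp_all add: rs)
    then have "snd u \<ge> snd v + h + 1" using block u by (auto simp: book_block_def)
    then have "book_dist u v \<ge> h + 1" by (simp add: book_dist_def)
    with g 1 show ?thesis using slot by (simp add: L_def)
  next
    case 2
    then show ?thesis using g r by (simp add: slot_label_def L_def g_def)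
  next
    case 3
    moreover from this have "r \<noteq> 2 * m - 1" using m by linarith
    ultimately show ?thesis using g r m by (simp add: slot_label_def L_def g_def)
  next
    case 4
    then have "3 * h \<le> g * h" by (rule mult_le_mono1)
    with g slot h show ?thesis unfolding L_def by linarith
  qed
  with L show ?thesis by (simp add: book_label_def rs L_def)
qed

lemma radio_labeling_book_label:
  assumes "m \<ge> 4" "h > 0"
  shows "radio_labeling (stacked_book m (2 * h)) (book_label m h)"
proof -
  have sym: "book_dist u v = book_dist v u" for u v
    by (auto simp: book_dist_def star_dist_def)
  have "\<bar>int (book_label m h u) - int (book_label m h v)\<bar> \<ge> int (2 * h) + 2 - int (book_dist u v)"
    if "u \<in> {..<m} \<times> {..<2 * h}" "v \<in> {..<m} \<times> {..<2 * h}" "u \<noteq> v" for u v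
  proof -
    have "book_label m h v + book_dist u v \<ge> book_label m h u + 2 * h + 2 \<or>
          book_label m h u + book_dist v u \<ge> book_label m h v + 2 * h + 2"
    proof (cases "book_block h u = book_block h v")
      case True
      then have "book_slot m h u \<noteq> book_slot m h v"
        using book_position_inj[OF assms(1) that(1,2)] that(3) by blast
      then show ?thesis
        using book_label_same_block[OF assms(1) that(1,2) True]
          book_label_same_block[OF assms(1) that(2,1) True[symmetric]] by linarith
    next
      case False
      then show ?thesis
        using book_label_less_block[OF assms(1) that(1,2)]
          book_label_less_block[OF assms(1) that(2,1)] by linarith
    qed
    then show ?thesis using sym[of u v] by linarith
  qed
  moreover have mn: "m \<ge> 3" "2 * h > 0" using assms by simp_all
  ultimately show ?thesis unfolding radio_labeling_stacked_book[OF mn] by blast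
qed

text \<open>Subtracting the minimum only lowers the span, so bounding the labels is enough; the
  bound is the label of slot \<open>2 * m - 1\<close> in block \<open>h - 1\<close>.\<close>

lemma label_span_book_label_le:
  assumes m: "m \<ge> 4" and h: "h > 0"
  shows "label_span (stacked_book m (2 * h)) (book_label m h) \<le> 2 * m * h\<^sup>2 + 2 * h - 1"
proof -
  have "book_label m h u \<le> 2 * m * h\<^sup>2 + 2 * h - 1" if "u \<in> {..<m} \<times> {..<2 * h}" for u
  proof -
    have r: "book_slot m h u < 2 * m" using book_slot_less[OF m] that by auto
    have "book_block h u \<le> h - 1" using that by (auto simp: book_block_def)
    then have "book_block h u * (2 * m * h + 3) \<le> (h - 1) * (2 * m * h + 3)" by (rule mult_le_mono1)
    moreover have "book_slot m h u * h \<le> (2 * m - 1) * h"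
      using r by (intro mult_le_mono1) simp
    then have "slot_label m h (book_slot m h u) \<le> (2 * m - 1) * h + 2"
      unfolding slot_label_def by (intro add_mono) auto
    moreover have "(h - 1) * (2 * m * h + 3) + ((2 * m - 1) * h + 2) = 2 * m * h\<^sup>2 + 2 * h - 1"
      using m h by (cases h; cases m) (simp_all add: power2_eq_square algebra_simps)
    ultimately show ?thesis unfolding book_label_def by linarith
  qed
  then have "Max (book_label m h ` ({..<m} \<times> {..<2 * h})) \<le> 2 * m * h\<^sup>2 + 2 * h - 1"
    using m h by (intro Max.boundedI) (auto simp: lessThan_empty_iff)
  then show ?thesis by (simp add: label_span_def pverts_stacked_book)
qed

lemma radio_number_stacked_book:
  assumes "m \<ge> 4" "h > 0"
  shows "radio_number (stacked_book m (2 * h)) = 2 * m * h\<^sup>2 + 2 * h - 1"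
  unfolding radio_number_def
proof (rule Least_equality)
  have "label_span (stacked_book m (2 * h)) (book_label m h) = 2 * m * h\<^sup>2 + 2 * h - 1"
    using assms radio_labeling_book_label
    by (intro antisym label_span_book_label_le label_span_stacked_book_ge) auto
  then show "\<exists>f. radio_labeling (stacked_book m (2 * h)) f \<and>
      label_span (stacked_book m (2 * h)) f = 2 * m * h\<^sup>2 + 2 * h - 1"
    using assms radio_labeling_book_label by blast
next
  fix k assume "\<exists>f. radio_labeling (stacked_book m (2 * h)) f \<and>
      label_span (stacked_book m (2 * h)) f = k"
  then obtain f where "radio_labeling (stacked_book m (2 * h)) f"
      "label_span (stacked_book m (2 * h)) f = k" by blast
  then show "2 * m * h\<^sup>2 + 2 * h - 1 \<le> k"
    using label_span_stacked_book_ge[of m h f] assms by linarith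
qed

theorem theorem3p10:
  fixes m n :: nat
  assumes "m \<ge> 4" and "n > 0" and "even n"
  shows "real (radio_number (stacked_book m n)) = real m * (real n)\<^sup>2 / 2 + real n - 1"
proof -
  obtain h where n: "n = 2 * h" using assms by blast
  with assms have "h > 0" by simp
  \<comment> \<open>Adding one removes the truncated subtraction before passing to the
    reals.\<close>
  then have "radio_number (stacked_book m n) + 1 = 2 * m * h\<^sup>2 + 2 * h"
    using assms by (simp add: n radio_number_stacked_book)
  then have "real (radio_number (stacked_book m n)) + 1 = real (2 * m * h\<^sup>2 + 2 * h)"
    by (metis of_nat_Suc Suc_eq_plus1 add.commute)
  then show ?thesis by (simp add: n power2_eq_square algebra_simps)
qed

end
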